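(* Let $\{X_i\}$ be a strictly stationary sequence of random variables with continuous marginal distribution function $F$. Assume that the conditions $D(u_n)$ and $D^{(d)}(u_n)$ hold for some integer $d\geq 1$ and that the stable tail dependence function $\ell_d$ exists. Then the extremal index $\theta$ of $\{X_i\}$ satisfies $$\theta=\ell_d(\mathbf 1_d)-\ell_{d-1}(\mathbf 1_{d-1})\in[0,1].$$ Moreover, if $\ell_{s_0}$ exists for some integer $s_0\geq d$, then there exists a positive integer $d^*\leq d$ such that for any integer $s$ with $d^*\leq s\leq s_0$ the condition $D^{(s)}(u_n)$ holds and $$\ell_s(\mathbf 1_s)-\ell_{s-1}(\mathbf 1_{s-1})=\theta;$$ and for any integer $s$ with $1\leq s<d^*$, $$\ell_s(\mathbf 1_s)-\ell_{s-1}(\mathbf 1_{s-1})>\theta.$$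
   Context: For $\tau>0$, $u_n=u_n(\tau)$ denotes a sequence of thresholds with $\lim_{n\to\infty}n(1-F(u_n(\tau)))=\tau$. Set $M_{i,j}:=\max_{i\le t\le j}X_t$ for $i\le j$ and $M_{i,j}:=-\infty$ for $i>j$. Extremal index: $\{X_i\}$ has extremal index $\theta\in[0,1]$ if $\lim_{n\to\infty}\mathbb P(\max_{1\le i\le n}X_i\le u_n(\tau))=e^{-\theta\tau}$ (for all $\tau>0$). Condition $D(u_n)$: for any integers $1\le i_1<\cdots<i_q<j_1<\cdots<j_{q'}\le n$ with $j_1-i_q\ge l$, $$\Big|\mathbb P\big(\max_{1\le t\le q}X_{i_t}\le u_n,\max_{1\le t\le q'}X_{j_t}\le u_n\big)-\mathbb P\big(\max_{1\le t\le q}X_{i_t}\le u_n\big)\mathbb P\big(\max_{1\le t\le q'}X_{j_t}\le u_n\big)\Big|\le\alpha_{n,l},$$ and $\lim_{n\to\infty}\alpha_{n,l_n}=0$ for some sequence $l_n\to\infty$ with $l_n=o(n)$. Condition $D^{(d)}(u_n)$ ($d$ a positive integer): there exist sequences of integers $r_n,l_n$ with $r_n\to\infty$, $n\alpha_{n,l_n}/r_n\to0$, $l_n/r_n\to0$ (with $\alpha_{n,l}$ as in $D(u_n)$) and $$\lim_{n\to\infty}n\,\mathbb P(X_1>u_n\ge M_{2,d},\ M_{d+1,r_n}>u_n)=0.$$ Both conditions are understood to hold for $u_n=u_n(\tau)$ for all $\tau>0$. Stable tail dependence function: for $d\ge1$ and positive $x_1,\dots,x_d$, $$\ell_d(x_1,\dots,x_d)=\lim_{n\to\infty}n\,\mathbb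 P\big(X_1>u_n(x_1)\text{ or }\dots\text{ or }X_d>u_n(x_d)\big);$$ "$\ell_d$ exists" means that this limit exists for all such arguments. $\mathbf 1_d=(1,\dots,1)\in\mathbb R^d$, and $\ell_0(\mathbf 1_0):=0$. *)

theory Defs
  imports "HOL-Probability.Probability" "HOL-Library.Landau_Symbols"
begin

text \<open>
  A sequence is a family \<open>X :: nat \<Rightarrow> 'a \<Rightarrow> real\<close> of which only the members with index
  at least \<open>1\<close> matter; \<open>X 0\<close> is never constrained and never used.  The threshold
  \<open>u\<^sub>n(\<tau>)\<close> is written \<open>u \<tau> n\<close>.
\<close>

definition strictly_stationary :: "'a measure \<Rightarrow> (nat \<Rightarrow> 'a \<Rightarrow> real) \<Rightarrow> bool" where
  "strictly_stationary M X \<longleftrightarrow>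
     (\<forall>J h. finite J \<and> J \<subseteq> {1..} \<longrightarrow>
        distr M (Pi\<^sub>M J (\<lambda>_. borel)) (\<lambda>\<omega>. \<lambda>i\<in>J. X (i + h) \<omega>)
      = distr M (Pi\<^sub>M J (\<lambda>_. borel)) (\<lambda>\<omega>. \<lambda>i\<in>J. X i \<omega>))"

text \<open>
  The maximum over an index set is taken in the extended reals, so that it is \<open>-\<infinity>\<close> over the
  empty set; \<open>M\<^sub>i\<^sub>,\<^sub>j\<close> is \<open>max_over X {i..j}\<close>, also when \<open>i > j\<close>.  Only finite index
  sets occur, for which the supremum is a maximum.
\<close>

definition max_over :: "(nat \<Rightarrow> 'a \<Rightarrow> real) \<Rightarrow> nat set \<Rightarrow> 'a \<Rightarrow> ereal" where
  "max_over X I \<omega> = (SUP t\<in>I. ereal (X t \<omega>))"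

definition thresholds :: "'a measure \<Rightarrow> (nat \<Rightarrow> 'a \<Rightarrow> real) \<Rightarrow> (real \<Rightarrow> nat \<Rightarrow> real) \<Rightarrow> bool" where
  "thresholds M X u \<longleftrightarrow>
     (\<forall>\<tau>>0. (\<lambda>n. real n * (1 - cdf (distr M borel (X 1)) (u \<tau> n))) \<longlonglongrightarrow> \<tau>)"

definition has_extremal_index ::
    "'a measure \<Rightarrow> (nat \<Rightarrow> 'a \<Rightarrow> real) \<Rightarrow> (real \<Rightarrow> nat \<Rightarrow> real) \<Rightarrow> real \<Rightarrow> bool" where
  "has_extremal_index M X u \<theta> \<longleftrightarrow> \<theta> \<in> {0..1} \<and>
     (\<forall>\<tau>>0. (\<lambda>n. \<P>(\<omega> in M. max_over X {1..n} \<omega> \<le> ereal (u \<tau> n))) \<longlonglongrightarrow> exp (- \<theta> * \<tau>))"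

text \<open>
  The mixing conditions are stated for a single threshold sequence \<open>v\<close> and for given bounds
  \<open>\<alpha> n l\<close>, since both conditions refer to the same \<open>\<alpha>\<close>.  The index sets \<open>I\<close> and \<open>J\<close> stand for
  \<open>{i\<^sub>1 < \<dots> < i\<^sub>q}\<close> and \<open>{j\<^sub>1 < \<dots> < j\<^sub>q'}\<close>.
\<close>

definition condition_D ::
    "'a measure \<Rightarrow> (nat \<Rightarrow> 'a \<Rightarrow> real) \<Rightarrow> (nat \<Rightarrow> real) \<Rightarrow> (nat \<Rightarrow> nat \<Rightarrow> real) \<Rightarrow> bool" where
  "condition_D M X v \<alpha> \<longleftrightarrow>
     (\<forall>n l I J. I \<noteq> {} \<and> J \<noteq> {} \<and> I \<subseteq> {1..n} \<and> J \<subseteq> {1..n} \<and>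
          Max I < Min J \<and> l \<le> Min J - Max I \<longrightarrow>
        \<bar>\<P>(\<omega> in M. max_over X I \<omega> \<le> ereal (v n) \<and> max_over X J \<omega> \<le> ereal (v n))
          - \<P>(\<omega> in M. max_over X I \<omega> \<le> ereal (v n)) * \<P>(\<omega> in M. max_over X J \<omega> \<le> ereal (v n))\<bar>
        \<le> \<alpha> n l) \<and>
     (\<exists>l :: nat \<Rightarrow> nat. filterlim l at_top sequentially \<and>
        (\<lambda>n. real (l n)) \<in> o(\<lambda>n. real n) \<and> (\<lambda>n. \<alpha> n (l n)) \<longlonglongrightarrow> 0)"

definition condition_Dd ::
    "'a measure \<Rightarrow> (nat \<Rightarrow> 'a \<Rightarrow> real) \<Rightarrow> (nat \<Rightarrow> real) \<Rightarrow> (nat \<Rightarrow> nat \<Rightarrow> real) \<Rightarrow> nat \<Rightarrow> bool" where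
  "condition_Dd M X v \<alpha> d \<longleftrightarrow>
     (\<exists>r l :: nat \<Rightarrow> nat. filterlim r at_top sequentially \<and>
        (\<lambda>n. real n * \<alpha> n (l n) / real (r n)) \<longlonglongrightarrow> 0 \<and>
        (\<lambda>n. real (l n) / real (r n)) \<longlonglongrightarrow> 0 \<and>
        (\<lambda>n. real n * \<P>(\<omega> in M. X 1 \<omega> > v n \<and> ereal (v n) \<ge> max_over X {2..d} \<omega> \<and>
                               max_over X {d + 1..r n} \<omega> > ereal (v n))) \<longlonglongrightarrow> 0)"

text \<open>
  The arguments \<open>x\<^sub>1, \<dots>, x\<^sub>d\<close> of \<open>\<ell>\<^sub>d\<close> are the values of \<open>x :: nat \<Rightarrow> real\<close> on \<open>{1..d}\<close>; so
  \<open>\<ell>\<^sub>d(1, \<dots>, 1)\<close> is \<open>stdf M X u d (\<lambda>_. 1)\<close>.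
\<close>

definition exceedance_seq :: "'a measure \<Rightarrow> (nat \<Rightarrow> 'a \<Rightarrow> real) \<Rightarrow> (real \<Rightarrow> nat \<Rightarrow> real) \<Rightarrow>
    nat \<Rightarrow> (nat \<Rightarrow> real) \<Rightarrow> nat \<Rightarrow> real" where
  "exceedance_seq M X u d x n = real n * \<P>(\<omega> in M. \<exists>i\<in>{1..d}. X i \<omega> > u (x i) n)"

definition stdf_exists ::
    "'a measure \<Rightarrow> (nat \<Rightarrow> 'a \<Rightarrow> real) \<Rightarrow> (real \<Rightarrow> nat \<Rightarrow> real) \<Rightarrow> nat \<Rightarrow> bool" where
  "stdf_exists M X u d \<longleftrightarrow>
     (\<forall>x. (\<forall>i\<in>{1..d}. x i > 0) \<longrightarrow> convergent (exceedance_seq M X u d x))"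

definition stdf :: "'a measure \<Rightarrow> (nat \<Rightarrow> 'a \<Rightarrow> real) \<Rightarrow> (real \<Rightarrow> nat \<Rightarrow> real) \<Rightarrow>
    nat \<Rightarrow> (nat \<Rightarrow> real) \<Rightarrow> real" where
  "stdf M X u d x = lim (exceedance_seq M X u d x)"

text \<open>The convention \<open>\<ell>\<^sub>0 = 0\<close> is built in, since the event is empty for \<open>d = 0\<close>.\<close>

lemma stdf_0: "stdf M X u 0 x = 0"
proof -
  have "exceedance_seq M X u 0 x = (\<lambda>_. 0)"
    by (simp add: exceedance_seq_def fun_eq_iff)
  then show ?thesis
    by (simp add: stdf_def)
qed

lemma stationary_tail:
  assumes M: "prob_space M"
    and X: "\<And>i. i \<ge> 1 \<Longrightarrow> X i \<in> borel_measurable M"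
    and st: "strictly_stationary M X" and k: "k \<ge> (1::nat)"
  shows "\<P>(\<omega> in M. X k \<omega> > t) = 1 - cdf (distr M borel (X 1)) t"
proof -
  interpret prob_space M by fact
  let ?P = "Pi\<^sub>M {1::nat} (\<lambda>_. borel :: real measure)"
  let ?A = "{f \<in> space ?P. f 1 > t}"
  have A: "?A \<in> sets ?P" by measurable
  have meas: "(\<lambda>\<omega>. \<lambda>i\<in>{1}. X (i + h) \<omega>) \<in> measurable M ?P" for h
    using X by (intro measurable_restrict) auto
  have eq: "distr M ?P (\<lambda>\<omega>. \<lambda>i\<in>{1}. X (i + (k - 1)) \<omega>) = distr M ?P (\<lambda>\<omega>. \<lambda>i\<in>{1}. X (i + 0) \<omega>)"
    using st unfolding strictly_stationary_def by auto
  have m: "measure (distr M ?P (\<lambda>\<omega>. \<lambda>i\<in>{1}. X (i + h) \<omega>)) ?A = \<P>(\<omega> in M. X (1 + h) \<omega> > t)" for h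
    unfolding measure_distr[OF meas A]
    by (rule arg_cong[where f = "measure M"]) (auto simp: space_PiM PiE_def extensional_def)
  have "\<P>(\<omega> in M. X k \<omega> > t) = \<P>(\<omega> in M. X 1 \<omega> > t)"
    using m[of "k - 1"] m[of 0] eq k by simp
  also have "\<dots> = 1 - \<P>(\<omega> in M. X 1 \<omega> \<le> t)"
  proof -
    have [measurable]: "X 1 \<in> borel_measurable M" using X by simp
    have "{\<omega> \<in> space M. X 1 \<omega> > t} = space M - {\<omega> \<in> space M. X 1 \<omega> \<le> t}" by auto
    moreover have "{\<omega> \<in> space M. X 1 \<omega> \<le> t} \<in> sets M" by measurable
    ultimately show ?thesis by (simp only: prob_compl)
  qed
  also have "\<P>(\<omega> in M. X 1 \<omega> \<le> t) = cdf (distr M borel (X 1)) t"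
    using X[of 1] by (simp add: cdf_def measure_distr vimage_def Int_def conj_commute)
  finally show ?thesis .
qed

text \<open>
  Existence of \<open>\<ell>\<^sub>d\<close> is inherited by all smaller dimensions, so \<open>stdf\<close> never denotes an
  unspecified value of \<open>lim\<close> below a dimension in which it exists.
\<close>

lemma stdf_exists_mono:
  assumes M: "prob_space M"
    and X: "\<And>i. i \<ge> 1 \<Longrightarrow> X i \<in> borel_measurable M"
    and st: "strictly_stationary M X" and u: "thresholds M X u"
    and ex: "stdf_exists M X u d" and "s \<le> d"
  shows "stdf_exists M X u s"
  using \<open>s \<le> d\<close> ex
proof (induction rule: inc_induct)
  case (step d)
  interpret prob_space M by fact
  have ev: "{\<omega> \<in> space M. \<exists>i\<in>{1..m}. X i \<omega> > c i} \<in> sets M" for m c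
  proof -
    have "{\<omega> \<in> space M. X i \<omega> > c i} \<in> sets M" if "i \<in> {1..m}" for i
    proof -
      have [measurable]: "X i \<in> borel_measurable M" using X that by simp
      show ?thesis by measurable
    qed
    then have "(\<Union>i\<in>{1..m}. {\<omega> \<in> space M. X i \<omega> > c i}) \<in> sets M" by blast
    also have "(\<Union>i\<in>{1..m}. {\<omega> \<in> space M. X i \<omega> > c i})
        = {\<omega> \<in> space M. \<exists>i\<in>{1..m}. X i \<omega> > c i}" by auto
    finally show ?thesis .
  qed
  have "stdf_exists M X u (Suc d)" using step by simp
  note ex = this[unfolded stdf_exists_def, rule_format]
  show ?case
    unfolding stdf_exists_def
  proof (intro allI impI)
    fix x :: "nat \<Rightarrow> real" assume x: "\<forall>i\<in>{1..d}. x i > 0"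
    let ?a = "exceedance_seq M X u d x"
    have "Cauchy ?a"
    proof (rule metric_CauchyI)
      fix e :: real assume e: "e > 0"
      define y where "y = x(Suc d := e / 8)"
      let ?b = "exceedance_seq M X u (Suc d) y"
      let ?c = "\<lambda>n. real n * (1 - cdf (distr M borel (X 1)) (u (e / 8) n))"
      have "\<forall>i\<in>{1..Suc d}. y i > 0" using x e by (auto simp: y_def)
      then have "Cauchy ?b" using ex by (blast intro: convergent_Cauchy)
      from metric_CauchyD[OF this, of "e / 4"] e
      obtain N where N: "\<And>m n. m \<ge> N \<Longrightarrow> n \<ge> N \<Longrightarrow> dist (?b m) (?b n) < e / 4" by auto
      have "?c \<longlonglongrightarrow> e / 8" using u e by (auto simp: thresholds_def)
      from order_tendstoD(2)[OF this, of "e / 4"] e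
      obtain N' where N': "\<And>n. n \<ge> N' \<Longrightarrow> ?c n < e / 4"
        unfolding eventually_sequentially by auto
      have close: "\<bar>?a n - ?b n\<bar> \<le> ?c n" for n
      proof -
        let ?A = "{\<omega> \<in> space M. \<exists>i\<in>{1..d}. X i \<omega> > u (x i) n}"
        let ?B = "{\<omega> \<in> space M. \<exists>i\<in>{1..Suc d}. X i \<omega> > u (y i) n}"
        let ?C = "{\<omega> \<in> space M. X (Suc d) \<omega> > u (e / 8) n}"
        have [measurable]: "X (Suc d) \<in> borel_measurable M" using X by simp
        have C: "?C \<in> sets M" by measurable
        have eq: "?B = ?A \<union> ?C"
          by (auto simp: y_def atLeastAtMostSuc_conv)
        have A: "?A \<in> sets M" by (rule ev)
        have "measure M ?A \<le> measure M ?B"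
          unfolding eq using A C by (intro finite_measure_mono) auto
        moreover have "measure M ?B \<le> measure M ?A + measure M ?C"
          unfolding eq using A C by (rule measure_Un_le)
        moreover have "measure M ?C = 1 - cdf (distr M borel (X 1)) (u (e / 8) n)"
          using stationary_tail[OF M X st, of "Suc d"] by simp
        ultimately have "\<bar>measure M ?A - measure M ?B\<bar> \<le> 1 - cdf (distr M borel (X 1)) (u (e / 8) n)"
          by linarith
        then have "real n * \<bar>measure M ?A - measure M ?B\<bar> \<le> ?c n"
          by (intro mult_left_mono) auto
        then show ?thesis
          by (simp add: exceedance_seq_def abs_mult flip: right_diff_distrib)
      qed
      have "dist (?a m) (?a n) < e" if "m \<ge> max N N'" "n \<ge> max N N'" for m n
        using N[of m n] N'[of m] N'[of n] close[of m] close[of n] that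
        unfolding dist_real_def by (simp add: abs_if split: if_splits)
      then show "\<exists>K. \<forall>m\<ge>K. \<forall>n\<ge>K. dist (?a m) (?a n) < e" by blast
    qed
    then show "convergent ?a" by (rule Cauchy_convergent)
  qed
qed (use ex in simp)

end

theory Submission
  imports Defs
begin

text \<open>
  Write \<open>q\<^sub>m\<close> for the probability that the first of \<open>m\<close> consecutive variables exceeds the threshold
  and the others do not. Removing the first variable from a maximum shows that \<open>q\<^sub>m\<close> is the
  difference of the exceedance probabilities of \<open>m\<close> and of \<open>m - 1\<close> variables, so that
  \<open>n q\<^sub>m\<close> converges to \<open>\<ell>\<^sub>m(\<tau>, \<dots>, \<tau>) - \<ell>\<^sub>m\<^sub>-\<^sub>1(\<tau>, \<dots>, \<tau>)\<close>. On the diagonal \<open>\<ell>\<^sub>m\<close> is homogeneous,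
  since the threshold at level \<open>\<tau>\<close> for \<open>n\<close> may be replaced by that at level \<open>1\<close> for
  \<open>\<lfloor>n / \<tau>\<rfloor>\<close>; hence the limit is \<open>\<tau> \<theta>\<^sub>m\<close> with \<open>\<theta>\<^sub>m = \<ell>\<^sub>m(1, \<dots>, 1) - \<ell>\<^sub>m\<^sub>-\<^sub>1(1, \<dots>, 1)\<close>
  (\<open>lone_exceedance_tendsto\<close>). As \<open>q\<^sub>m\<close> lies between \<open>0\<close> and the marginal tail and decreases in
  \<open>m\<close>, the numbers \<open>\<theta>\<^sub>m\<close> lie in \<open>[0, 1]\<close> and decrease.

  For the extremal index, cut \<open>{1..n}\<close> into blocks of length \<open>r\<close>, where \<open>r \<longlonglongrightarrow> \<infinity>\<close> and \<open>r = o(n)\<close>.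
  Leaving short gaps between the blocks, the mixing condition makes the probability of no
  exceedance among \<open>n\<close> variables asymptotic to \<open>(1 - x)\<^sup>k\<close>, with \<open>x\<close> the probability of an
  exceedance in one block and \<open>k \<sim> n / r\<close> (\<open>no_exceedance_near_power\<close>). Locating the last
  exceedance of the block gives \<open>x = q\<^sub>1 + \<dots> + q\<^sub>r\<close>. All terms from \<open>q\<^sub>d\<close> on lie between \<open>q\<^sub>r\<close> and
  \<open>q\<^sub>d\<close>, and \<open>q\<^sub>d - q\<^sub>r\<close> is the probability of an exceedance that is followed by \<open>d - 1\<close> quiet
  variables and then by another exceedance within the block, which the local condition makes
  \<open>o(1 / n)\<close>. Thus \<open>k x\<close> has the same limit \<open>\<tau> \<theta>\<^sub>d\<close> as \<open>n q\<^sub>d\<close>, and the limit of \<open>(1 - x)\<^sup>k\<close> is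
  \<open>exp (- \<theta>\<^sub>d \<tau>)\<close> (\<open>no_exceedance_tendsto_exp\<close>).

  The same identity for \<open>q\<^sub>s - q\<^sub>d\<close> shows when other values of \<open>s\<close> may take the place of \<open>d\<close>.
  For \<open>s \<ge> d\<close> the local condition passes from \<open>d\<close> to \<open>s\<close> and forces \<open>\<theta>\<^sub>s = \<theta>\<^sub>d\<close>; for \<open>s \<le> d\<close> it passes
  from \<open>d\<close> to \<open>s\<close> as soon as \<open>\<theta>\<^sub>s = \<theta>\<^sub>d\<close>. The number sought is therefore the least \<open>s\<close> with
  \<open>\<theta>\<^sub>s = \<theta>\<^sub>d\<close>, below which \<open>\<theta>\<^sub>s > \<theta>\<^sub>d\<close> by monotonicity.
\<close>

section \<open>Stationary sequences and a single threshold\<close>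

lemma max_over_le_iff: "max_over X I \<omega> \<le> ereal c \<longleftrightarrow> (\<forall>i\<in>I. X i \<omega> \<le> c)"
  by (simp add: max_over_def SUP_le_iff)

lemma less_max_over_iff: "ereal c < max_over X I \<omega> \<longleftrightarrow> (\<exists>i\<in>I. c < X i \<omega>)"
  by (simp add: max_over_def less_SUP_iff)

locale stationary_sequence = prob_space M for M :: "'a measure" +
  fixes X :: "nat \<Rightarrow> 'a \<Rightarrow> real"
  assumes measurable_X: "\<And>i. i \<ge> 1 \<Longrightarrow> X i \<in> borel_measurable M"
    and stationary: "strictly_stationary M X"
begin

definition below :: "real \<Rightarrow> nat set \<Rightarrow> 'a set" where
  "below c I = {\<omega> \<in> space M. \<forall>i\<in>I. X i \<omega> \<le> c}"

definition tail :: "real \<Rightarrow> real" where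
  "tail c = 1 - cdf (distr M borel (X 1)) c"

definition no_exceedance :: "real \<Rightarrow> nat \<Rightarrow> real" where
  "no_exceedance c m = prob (below c {1..m})"

text \<open>By stationarity this is also the probability that the last exceedance in a block of length
  \<open>r\<close> occurs at its position \<open>r + 1 - m\<close>. Summed over \<open>m\<close>, these probabilities therefore
  give that of some exceedance in the block.\<close>

definition lone_exceedance :: "real \<Rightarrow> nat \<Rightarrow> real" where
  "lone_exceedance c m = prob {\<omega> \<in> space M. X 1 \<omega> > c \<and> (\<forall>i\<in>{2..m}. X i \<omega> \<le> c)}"

definition late_return :: "real \<Rightarrow> nat \<Rightarrow> nat \<Rightarrow> real" where
  "late_return c s r = prob {\<omega> \<in> space M. X 1 \<omega> > c \<and> (\<forall>i\<in>{2..s}. X i \<omega> \<le> c) \<and>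
                                            (\<exists>i\<in>{s + 1..r}. X i \<omega> > c)}"

lemma sets_atMost [measurable]: "i \<ge> 1 \<Longrightarrow> {\<omega> \<in> space M. X i \<omega> \<le> c} \<in> events"
  using measurable_X by measurable

lemma sets_greater [measurable]: "i \<ge> 1 \<Longrightarrow> {\<omega> \<in> space M. X i \<omega> > c} \<in> events"
  using measurable_X by measurable

lemma sets_all_le [measurable]:
  "I \<subseteq> {1..} \<Longrightarrow> {\<omega> \<in> space M. \<forall>i\<in>I. X i \<omega> \<le> c} \<in> events"
  by (intro sets.sets_Collect_countable_All' sets_atMost countable_subset[of I UNIV]) auto

lemma sets_below [measurable]: "I \<subseteq> {1..} \<Longrightarrow> below c I \<in> events"
  unfolding below_def by (rule sets_all_le)

lemma sets_ex_greater [measurable]: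
  "I \<subseteq> {1..} \<Longrightarrow> {\<omega> \<in> space M. \<exists>i\<in>I. X i \<omega> > c} \<in> events"
  by (intro sets.sets_Collect_countable_Ex' sets_greater countable_subset[of I UNIV]) auto

lemma sets_lone: "{\<omega> \<in> space M. X 1 \<omega> > c \<and> (\<forall>i\<in>{2..m}. X i \<omega> \<le> c)} \<in> events"
  by (intro sets.sets_Collect_conj sets_greater sets_all_le) auto

lemma sets_late:
  "{\<omega> \<in> space M. X 1 \<omega> > c \<and> (\<forall>i\<in>{2..s}. X i \<omega> \<le> c) \<and> (\<exists>i\<in>{s + 1..r}. X i \<omega> > c)} \<in> events"
  by (intro sets.sets_Collect_conj sets_greater sets_all_le sets_ex_greater) auto

lemma prob_greater: "k \<ge> 1 \<Longrightarrow> prob {\<omega> \<in> space M. X k \<omega> > c} = tail c"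
  unfolding tail_def
  by (rule stationary_tail[OF prob_space_axioms measurable_X stationary])

lemma tail_nonneg: "0 \<le> tail c"
  using prob_greater[of 1 c] measure_nonneg by (metis order_refl)

lemma prob_below_shift:
  assumes I: "finite I" "I \<subseteq> {1..}"
  shows "prob (below c ((\<lambda>i. i + h) ` I)) = prob (below c I)"
proof -
  let ?P = "Pi\<^sub>M I (\<lambda>_. borel :: real measure)"
  let ?A = "{f \<in> space ?P. \<forall>i\<in>I. f i \<le> c}"
  have A: "?A \<in> sets ?P"
    using I(1) by measurable
  have m: "measure (distr M ?P (\<lambda>\<omega>. \<lambda>i\<in>I. X (i + k) \<omega>)) ?A = prob (below c ((\<lambda>i. i + k) ` I))" for k
  proof -
    have "(\<lambda>\<omega>. \<lambda>i\<in>I. X (i + k) \<omega>) \<in> measurable M ?P"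
      using I(2) measurable_X by (intro measurable_restrict) (auto simp: subset_iff)
    from measure_distr[OF this A] show ?thesis
      by (auto simp: below_def space_PiM PiE_def extensional_def intro!: arg_cong[where f = prob])
  qed
  have "distr M ?P (\<lambda>\<omega>. \<lambda>i\<in>I. X (i + h) \<omega>) = distr M ?P (\<lambda>\<omega>. \<lambda>i\<in>I. X (i + 0) \<omega>)"
    using stationary I unfolding strictly_stationary_def by simp
  with m[of h] m[of 0] show ?thesis by simp
qed

lemma prob_below_interval: "prob (below c {a + 1..a + m}) = no_exceedance c m"
proof -
  have *: "{a + 1..a + m} = (\<lambda>i. i + a) ` {1..m}"
    by (simp add: add.commute)
  show ?thesis
    unfolding * no_exceedance_def by (rule prob_below_shift) auto
qed

lemma prob_below_Un:
  assumes "I \<subseteq> {1..}" "J \<subseteq> {1..}" "finite J"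
  shows "prob (below c (I \<union> J)) \<le> prob (below c I)"
    and "prob (below c I) \<le> prob (below c (I \<union> J)) + real (card J) * tail c"
proof -
  have IJ: "I \<union> J \<subseteq> {1..}" using assms by auto
  show "prob (below c (I \<union> J)) \<le> prob (below c I)"
    using assms by (intro finite_measure_mono sets_below) (auto simp: below_def)
  let ?E = "\<lambda>i. {\<omega> \<in> space M. X i \<omega> > c}"
  have E: "?E ` J \<subseteq> events" using assms sets_greater by auto
  have "prob (below c I) \<le> prob (below c (I \<union> J) \<union> (\<Union>i\<in>J. ?E i))"
    using assms IJ E by (intro finite_measure_mono sets.Un sets_below sets.finite_UN)
      (auto simp: below_def not_le)
  also have "\<dots> \<le> prob (below c (I \<union> J)) + prob (\<Union>i\<in>J. ?E i)"
    using assms IJ E by (intro measure_Un_le sets_below sets.finite_UN) auto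
  also have "prob (\<Union>i\<in>J. ?E i) \<le> (\<Sum>i\<in>J. prob (?E i))"
    using assms E by (intro finite_measure_subadditive_finite) auto
  also have "\<dots> = (\<Sum>i\<in>J. tail c)"
    using assms by (intro sum.cong prob_greater) auto
  finally show "prob (below c I) \<le> prob (below c (I \<union> J)) + real (card J) * tail c"
    by simp
qed

lemma no_exceedance_bounds: "0 \<le> no_exceedance c m" "no_exceedance c m \<le> 1"
  by (auto simp: no_exceedance_def)

lemma no_exceedance_0: "no_exceedance c 0 = 1"
  by (simp add: no_exceedance_def below_def prob_space)

lemma no_exceedance_antimono: "a \<le> b \<Longrightarrow> no_exceedance c b \<le> no_exceedance c a"
  unfolding no_exceedance_def
  by (intro finite_measure_mono sets_below) (auto simp: below_def)

lemma no_exceedance_decrement: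
  assumes "a \<le> b"
  shows "no_exceedance c a - no_exceedance c b \<le> real (b - a) * tail c"
proof -
  have "{1..a} \<union> {a + 1..b} = {1..b}" using assms by auto
  then show ?thesis
    using prob_below_Un(2)[of "{1..a}" "{a + 1..b}" c] by (simp add: no_exceedance_def)
qed

lemma exceedance_seq_eq:
  "exceedance_seq M X u m (\<lambda>_. \<tau>) n = real n * (1 - no_exceedance (u \<tau> n) m)"
proof -
  have "{\<omega> \<in> space M. \<exists>i\<in>{1..m}. X i \<omega> > u \<tau> n} = space M - below (u \<tau> n) {1..m}"
    by (auto simp: below_def not_le)
  then show ?thesis
    by (simp add: exceedance_seq_def no_exceedance_def prob_compl)
qed

lemma lone_exceedance_eq:
  assumes "m \<ge> 1"
  shows "lone_exceedance c m = no_exceedance c (m - 1) - no_exceedance c m"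
proof -
  have split: "{1..m} = insert 1 {1 + 1..1 + (m - 1)}" using assms by auto
  have "{\<omega> \<in> space M. X 1 \<omega> > c \<and> (\<forall>i\<in>{2..m}. X i \<omega> \<le> c)}
      = below c {1 + 1..1 + (m - 1)} - below c {1..m}"
    unfolding split using assms by (auto simp: below_def not_le numeral_2_eq_2)
  moreover have "below c {1..m} \<subseteq> below c {1 + 1..1 + (m - 1)}"
    unfolding split by (auto simp: below_def)
  ultimately show ?thesis
    using prob_below_interval[of c 1 "m - 1"]
    by (simp add: lone_exceedance_def finite_measure_Diff no_exceedance_def)
qed

lemma lone_exceedance_nonneg: "0 \<le> lone_exceedance c m"
  by (simp add: lone_exceedance_def)

lemma lone_exceedance_antimono: "a \<le> b \<Longrightarrow> lone_exceedance c b \<le> lone_exceedance c a"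
  unfolding lone_exceedance_def by (intro finite_measure_mono sets_lone) auto

lemma lone_exceedance_le_tail: "lone_exceedance c m \<le> tail c"
  unfolding lone_exceedance_def prob_greater[of 1, simplified, symmetric]
  using sets_greater[of 1] by (intro finite_measure_mono) auto

lemma one_minus_no_exceedance: "1 - no_exceedance c r = (\<Sum>m=1..r. lone_exceedance c m)"
proof (induction r)
  case (Suc r)
  then show ?case using lone_exceedance_eq[of "Suc r" c] by simp
qed (simp add: no_exceedance_0)

lemma late_return_nonneg: "0 \<le> late_return c s r"
  by (simp add: late_return_def)

lemma late_return_mono: "r \<le> r' \<Longrightarrow> late_return c s r \<le> late_return c s r'"
  unfolding late_return_def by (intro finite_measure_mono sets_late Collect_mono) fastforce

lemma late_return_antimono:
  assumes "s \<le> s'"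
  shows "late_return c s' r \<le> late_return c s r"
proof -
  have "{2..s} \<subseteq> {2..s'}" "{s' + 1..r} \<subseteq> {s + 1..r}" using assms by auto
  then show ?thesis
    unfolding late_return_def by (intro finite_measure_mono sets_late) blast
qed

lemma late_return_eq:
  assumes "1 \<le> s" "s \<le> r"
  shows "late_return c s r = lone_exceedance c s - lone_exceedance c r"
proof -
  let ?L = "\<lambda>m. {\<omega> \<in> space M. X 1 \<omega> > c \<and> (\<forall>i\<in>{2..m}. X i \<omega> \<le> c)}"
  have un: "{2..r} = {2..s} \<union> {s + 1..r}" using assms by auto
  have ex: "(\<exists>i\<in>{s + 1..r}. X i \<omega> > c) \<longleftrightarrow> \<not> (\<forall>i\<in>{s + 1..r}. X i \<omega> \<le> c)" for \<omega>
    by (simp add: not_le)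
  have "{\<omega> \<in> space M. X 1 \<omega> > c \<and> (\<forall>i\<in>{2..s}. X i \<omega> \<le> c) \<and> (\<exists>i\<in>{s + 1..r}. X i \<omega> > c)}
      = ?L s - ?L r"
    unfolding un ball_Un ex by blast
  moreover have "?L r \<subseteq> ?L s" unfolding un ball_Un by blast
  ultimately show ?thesis
    by (simp only: late_return_def lone_exceedance_def finite_measure_Diff[OF sets_lone sets_lone])
qed

text \<open>After quiet times up to \<open>s\<close>, either an exceedance follows by time \<open>d\<close>, or the quiet times
  extend to \<open>d\<close> and the exceedance comes later.\<close>

lemma late_return_split:
  assumes "1 \<le> s" "s \<le> d"
  shows "late_return c s r \<le> (lone_exceedance c s - lone_exceedance c d) + late_return c d r"
proof -
  let ?E = "\<lambda>s r. {\<omega> \<in> space M. X 1 \<omega> > c \<and> (\<forall>i\<in>{2..s}. X i \<omega> \<le> c) \<and> (\<exists>i\<in>{s + 1..r}. X i \<omega> > c)}"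
  have "?E s r \<subseteq> ?E s d \<union> ?E d r"
  proof
    fix \<omega> assume \<omega>: "\<omega> \<in> ?E s r"
    then obtain i where i: "s + 1 \<le> i" "i \<le> r" "X i \<omega> > c" by auto
    show "\<omega> \<in> ?E s d \<union> ?E d r"
    proof (cases "\<exists>j\<in>{s + 1..d}. X j \<omega> > c")
      case False
      then have "\<forall>j\<in>{2..d}. X j \<omega> \<le> c"
        using \<omega> by (metis (no_types, lifting) mem_Collect_eq atLeastAtMost_iff
            add.commute not_less not_less_eq_eq plus_1_eq_Suc)
      moreover have "i \<ge> d + 1"
        using False i by (metis Suc_eq_plus1 atLeastAtMost_iff not_less_eq_eq)
      ultimately show ?thesis using \<omega> i by auto
    qed (use \<omega> in auto)
  qed
  then have "late_return c s r \<le> late_return c s d + late_return c d r"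
    unfolding late_return_def
    by (intro order_trans[OF finite_measure_mono measure_Un_le] sets_late sets.Un)
  then show ?thesis using late_return_eq[OF assms] by simp
qed

lemma no_exceedance_diff_le:
  "\<bar>no_exceedance c m - no_exceedance c' m\<bar> \<le> real m * \<bar>tail c - tail c'\<bar>"
proof -
  have *: "\<bar>no_exceedance c m - no_exceedance c' m\<bar> \<le> real m * \<bar>tail c - tail c'\<bar>" if "c \<le> c'" for c c'
  proof -
    let ?E = "\<lambda>i. {\<omega> \<in> space M. X i \<omega> > c} - {\<omega> \<in> space M. X i \<omega> > c'}"
    have E: "?E ` {1..m} \<subseteq> events" by (intro image_subsetI sets.Diff sets_greater) auto
    have pE: "prob (?E i) = tail c - tail c'" if "i \<in> {1..m}" for i
      using that \<open>c \<le> c'\<close> prob_greater[of i]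
      by (subst finite_measure_Diff) (auto intro: sets_greater)
    have "below c' {1..m} \<subseteq> below c {1..m} \<union> (\<Union>i\<in>{1..m}. ?E i)"
    proof
      fix \<omega> assume \<omega>: "\<omega> \<in> below c' {1..m}"
      show "\<omega> \<in> below c {1..m} \<union> (\<Union>i\<in>{1..m}. ?E i)"
      proof (cases "\<forall>i\<in>{1..m}. X i \<omega> \<le> c")
        case False
        then obtain i where "i \<in> {1..m}" "X i \<omega> > c" by (auto simp: not_le)
        then show ?thesis using \<omega> by (fastforce simp: below_def)
      qed (use \<omega> in \<open>auto simp: below_def\<close>)
    qed
    then have "no_exceedance c' m \<le> prob (below c {1..m} \<union> (\<Union>i\<in>{1..m}. ?E i))"
      unfolding no_exceedance_def
      using E by (intro finite_measure_mono sets.Un sets_below sets.finite_UN) auto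
    also have "\<dots> \<le> no_exceedance c m + prob (\<Union>i\<in>{1..m}. ?E i)"
      unfolding no_exceedance_def
      using E by (intro measure_Un_le sets_below sets.finite_UN) auto
    also have "prob (\<Union>i\<in>{1..m}. ?E i) \<le> (\<Sum>i\<in>{1..m}. prob (?E i))"
      using E by (intro finite_measure_subadditive_finite) auto
    also have "\<dots> = real m * (tail c - tail c')"
      by (simp add: pE)
    also have "\<dots> \<le> real m * \<bar>tail c - tail c'\<bar>"
      by (intro mult_left_mono) auto
    finally have "no_exceedance c' m - no_exceedance c m \<le> real m * \<bar>tail c - tail c'\<bar>" by simp
    moreover have "no_exceedance c m \<le> no_exceedance c' m"
      unfolding no_exceedance_def using that
      by (intro finite_measure_mono sets_below) (auto simp: below_def intro: order_trans)
    ultimately show ?thesis by simp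
  qed
  show ?thesis
    using *[of c c'] *[of c' c] by (cases "c \<le> c'") (auto simp: abs_minus_commute)
qed

section \<open>Homogeneity of the stable tail dependence function on the diagonal\<close>

text \<open>The threshold \<open>u \<tau> n\<close> and the threshold \<open>u 1 \<lfloor>n / \<tau>\<rfloor>\<close> are exceeded with asymptotically equal
  probabilities, and over \<open>m\<close> variables a change of threshold alters the probability of an
  exceedance by at most \<open>m\<close> times the change of the marginal tail.\<close>

lemma exceedance_seq_tendsto_scaled:
  assumes u: "thresholds M X u" and \<tau>: "\<tau> > 0"
    and lim: "exceedance_seq M X u m (\<lambda>_. 1) \<longlonglongrightarrow> L"
  shows "exceedance_seq M X u m (\<lambda>_. \<tau>) \<longlonglongrightarrow> \<tau> * L"
proof -
  define N where "N n = nat \<lfloor>real n / \<tau>\<rfloor>" for n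
  define \<rho> where "\<rho> n = real n / real (N n)" for n
  have "filterlim (\<lambda>n. (1 / \<tau>) * real n) at_top sequentially"
    using \<tau> by (intro filterlim_tendsto_pos_mult_at_top[OF tendsto_const] filterlim_real_sequentially) auto
  then have N_top: "filterlim N at_top sequentially"
    unfolding N_def
    by (intro filterlim_compose[OF filterlim_nat_sequentially]
          filterlim_compose[OF filterlim_floor_sequentially]) simp
  have "(\<lambda>n. real (N n) / real n) \<longlonglongrightarrow> 1 / \<tau>"
  proof (rule tendsto_sandwich)
    have "real n / \<tau> - 1 \<le> real (N n)" "real (N n) \<le> real n / \<tau>" for n
      using \<tau> unfolding N_def by (auto simp: of_nat_nat)
    note N = this
    show "\<forall>\<^sub>F n in sequentially. 1 / \<tau> - 1 / real n \<le> real (N n) / real n"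
      using eventually_gt_at_top[of 0]
    proof eventually_elim
      case (elim n)
      then show ?case using N(1)[of n] divide_right_mono[OF N(1)[of n], of "real n"] \<tau>
        by (simp add: diff_divide_distrib)
    qed
    show "\<forall>\<^sub>F n in sequentially. real (N n) / real n \<le> 1 / \<tau>"
      using eventually_gt_at_top[of 0]
    proof eventually_elim
      case (elim n)
      then show ?case using divide_right_mono[OF N(2)[of n], of "real n"] \<tau> by simp
    qed
    show "(\<lambda>n. 1 / \<tau> - 1 / real n) \<longlonglongrightarrow> 1 / \<tau>"
      using tendsto_diff[OF tendsto_const lim_1_over_n] by simp
  qed simp
  from tendsto_inverse[OF this] \<tau> have \<rho>: "\<rho> \<longlonglongrightarrow> \<tau>"
    by (simp add: \<rho>_def[abs_def] inverse_eq_divide)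
  have transfer: "(\<lambda>n. real n * f (N n)) \<longlonglongrightarrow> \<tau> * K"
    if "(\<lambda>n. real n * f n) \<longlonglongrightarrow> K" for f K
  proof -
    have "(\<lambda>n. \<rho> n * (real (N n) * f (N n))) \<longlonglongrightarrow> \<tau> * K"
      by (intro tendsto_mult \<rho> filterlim_compose[OF that N_top])
    moreover have "\<forall>\<^sub>F n in sequentially. N n > 0"
      using eventually_compose_filterlim[OF eventually_gt_at_top N_top] .
    then have "\<forall>\<^sub>F n in sequentially. \<rho> n * (real (N n) * f (N n)) = real n * f (N n)"
      by eventually_elim (simp add: \<rho>_def)
    ultimately show ?thesis by (rule Lim_transform_eventually)
  qed
  have tail: "(\<lambda>n. real n * tail (u t n)) \<longlonglongrightarrow> t" if "t > 0" for t
    using u that by (simp add: thresholds_def tail_def)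
  have L: "(\<lambda>n. real n * (1 - no_exceedance (u 1 (N n)) m)) \<longlonglongrightarrow> \<tau> * L"
    using transfer[OF lim[unfolded exceedance_seq_eq]] .
  have "(\<lambda>n. real n * tail (u \<tau> n) - real n * tail (u 1 (N n))) \<longlonglongrightarrow> \<tau> - \<tau> * 1"
    by (intro tendsto_diff tail \<tau> transfer) auto
  then have "(\<lambda>n. real m * \<bar>real n * tail (u \<tau> n) - real n * tail (u 1 (N n))\<bar>) \<longlonglongrightarrow> 0"
    by (intro tendsto_mult_right_zero tendsto_rabs_zero) simp
  then have "(\<lambda>n. real n * (1 - no_exceedance (u \<tau> n) m) - real n * (1 - no_exceedance (u 1 (N n)) m))
      \<longlonglongrightarrow> 0"
  proof (rule Lim_null_comparison[rotated], intro always_eventually allI)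
    fix n
    have "norm (real n * (1 - no_exceedance (u \<tau> n) m) - real n * (1 - no_exceedance (u 1 (N n)) m))
        = real n * \<bar>no_exceedance (u \<tau> n) m - no_exceedance (u 1 (N n)) m\<bar>"
      by (simp add: abs_minus_commute abs_mult flip: right_diff_distrib)
    also have "\<dots> \<le> real n * (real m * \<bar>tail (u \<tau> n) - tail (u 1 (N n))\<bar>)"
      by (intro mult_left_mono no_exceedance_diff_le) auto
    also have "\<dots> = real m * \<bar>real n * tail (u \<tau> n) - real n * tail (u 1 (N n))\<bar>"
      by (simp add: abs_mult flip: right_diff_distrib)
    finally show "norm (real n * (1 - no_exceedance (u \<tau> n) m) - real n * (1 - no_exceedance (u 1 (N n)) m))
        \<le> real m * \<bar>real n * tail (u \<tau> n) - real n * tail (u 1 (N n))\<bar>" .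
  qed
  from tendsto_add[OF this L] show ?thesis by (simp add: exceedance_seq_eq[abs_def])
qed

lemma lone_exceedance_tendsto:
  assumes u: "thresholds M X u" and ex: "stdf_exists M X u s" and "1 \<le> s" and \<tau>: "\<tau> > 0"
  shows "(\<lambda>n. real n * lone_exceedance (u \<tau> n) s)
           \<longlonglongrightarrow> \<tau> * (stdf M X u s (\<lambda>_. 1) - stdf M X u (s - 1) (\<lambda>_. 1))"
proof -
  have "exceedance_seq M X u m (\<lambda>_. 1) \<longlonglongrightarrow> stdf M X u m (\<lambda>_. 1)" if "m \<le> s" for m
    using stdf_exists_mono[OF prob_space_axioms measurable_X stationary u ex that]
    by (simp add: stdf_exists_def stdf_def convergent_LIMSEQ_iff)
  then have "exceedance_seq M X u m (\<lambda>_. \<tau>) \<longlonglongrightarrow> \<tau> * stdf M X u m (\<lambda>_. 1)" if "m \<le> s" for m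
    using exceedance_seq_tendsto_scaled[OF u \<tau>] that by blast
  from tendsto_diff[OF this[of s] this[of "s - 1"]] \<open>1 \<le> s\<close> show ?thesis
    by (simp add: exceedance_seq_eq lone_exceedance_eq algebra_simps)
qed

section \<open>Factorisation over blocks\<close>

definition separated_mixing :: "real \<Rightarrow> nat \<Rightarrow> nat \<Rightarrow> real \<Rightarrow> bool" where
  "separated_mixing c n l A \<longleftrightarrow>
     (\<forall>I J. I \<noteq> {} \<and> J \<noteq> {} \<and> I \<subseteq> {1..n} \<and> J \<subseteq> {1..n} \<and> Max I < Min J \<and> l \<le> Min J - Max I \<longrightarrow>
        \<bar>prob (below c (I \<union> J)) - prob (below c I) * prob (below c J)\<bar> \<le> A)"

lemma condition_D_separated_mixing:
  assumes "condition_D M X v \<alpha>"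
  shows "separated_mixing (v n) n l (\<alpha> n l)"
proof -
  have "{\<omega> \<in> space M. max_over X I \<omega> \<le> ereal c \<and> max_over X J \<omega> \<le> ereal c} = below c (I \<union> J)"
    "{\<omega> \<in> space M. max_over X I \<omega> \<le> ereal c} = below c I" for I J c
    by (auto simp: max_over_le_iff below_def)
  then show ?thesis
    using assms unfolding condition_D_def separated_mixing_def by simp
qed

text \<open>Omitting the \<open>l\<close> variables that follow the first \<open>a\<close> separates the two index sets; each of the
  two omissions, in the joint probability and in the second factor, costs at most \<open>l * tail c\<close>.\<close>

lemma no_exceedance_near_multiplicative:
  assumes mix: "separated_mixing c n l A" and a: "1 \<le> a" and l: "l < r" and n: "a + r \<le> n"
  shows "\<bar>no_exceedance c (a + r) - no_exceedance c a * no_exceedance c r\<bar>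
           \<le> 2 * (real l * tail c) + A"
proof -
  let ?J = "{a + l + 1..a + r}"
  have J: "prob (below c ?J) = no_exceedance c (r - l)"
    using prob_below_interval[of c "a + l" "r - l"] l by simp
  have "Max {1..a} = a" "Min ?J = a + l + 1"
    using a l by (auto intro!: Max_eqI Min_eqI)
  then have "\<bar>prob (below c ({1..a} \<union> ?J)) - prob (below c {1..a}) * prob (below c ?J)\<bar> \<le> A"
    using a l n by (intro mix[unfolded separated_mixing_def, rule_format]) auto
  then have 1: "\<bar>prob (below c ({1..a} \<union> ?J)) - no_exceedance c a * no_exceedance c (r - l)\<bar> \<le> A"
    by (simp only: J flip: no_exceedance_def)
  have "({1..a} \<union> ?J) \<union> {a + 1..a + l} = {1..a + r}"
    using l by auto
  then have 2: "no_exceedance c (a + r) \<le> prob (below c ({1..a} \<union> ?J))"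
    "prob (below c ({1..a} \<union> ?J)) \<le> no_exceedance c (a + r) + real l * tail c"
    using prob_below_Un[of "{1..a} \<union> ?J" "{a + 1..a + l}" c] by (auto simp: no_exceedance_def)
  have 3: "no_exceedance c r \<le> no_exceedance c (r - l)"
    "no_exceedance c (r - l) - no_exceedance c r \<le> real l * tail c"
    using no_exceedance_decrement[of "r - l" r c] l by (auto intro: no_exceedance_antimono)
  have "no_exceedance c a * (no_exceedance c (r - l) - no_exceedance c r) \<le> 1 * (real l * tail c)"
    using 3 no_exceedance_bounds by (intro mult_mono) auto
  moreover have "0 \<le> no_exceedance c a * (no_exceedance c (r - l) - no_exceedance c r)"
    using 3 no_exceedance_bounds by simp
  ultimately show ?thesis
    using 1 2 unfolding right_diff_distrib by linarith
qed

lemma no_exceedance_near_power: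
  assumes mix: "separated_mixing c n l A" and "0 \<le> A" and l: "l < r"
  shows "j * r \<le> n \<Longrightarrow>
    \<bar>no_exceedance c (j * r) - no_exceedance c r ^ j\<bar> \<le> real j * (2 * (real l * tail c) + A)"
proof (induction j)
  case (Suc j)
  let ?e = "2 * (real l * tail c) + A"
  let ?g = "no_exceedance c"
  have e: "0 \<le> ?e" using \<open>0 \<le> A\<close> tail_nonneg by simp
  show ?case
  proof (cases "j = 0")
    case False
    have "\<bar>?g (j * r + r) - ?g (j * r) * ?g r\<bar> \<le> ?e"
      using False l Suc.prems by (intro no_exceedance_near_multiplicative[OF mix]) (auto simp: Suc_le_eq)
    moreover have "\<bar>?g (j * r) * ?g r - ?g r ^ Suc j\<bar> \<le> real j * ?e"
    proof -
      have "\<bar>?g (j * r) * ?g r - ?g r ^ Suc j\<bar> = ?g r * \<bar>?g (j * r) - ?g r ^ j\<bar>"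
        using no_exceedance_bounds(1)[of c r]
        by (simp add: abs_mult mult.commute[of _ "?g r"] flip: right_diff_distrib)
      also have "\<dots> \<le> 1 * (real j * ?e)"
        using Suc no_exceedance_bounds[of c r] by (intro mult_mono) auto
      finally show ?thesis by simp
    qed
    ultimately show ?thesis by (simp add: algebra_simps)
  qed (use e in simp)
qed (simp add: no_exceedance_0)

section \<open>Probability of an exceedance in a long block\<close>

text \<open>Split according to the position of the last exceedance: one that leaves at least \<open>d - 1\<close>
  variables after it contributes at most \<open>lone_exceedance c d\<close>, and each of the remaining
  positions, fewer than \<open>d\<close> in number, at most \<open>tail c\<close>.\<close>

lemma exceedance_le_lone:
  assumes "d \<ge> 1"
  shows "1 - no_exceedance c r \<le> real d * tail c + real r * lone_exceedance c d"
proof (induction r)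
  case (Suc r)
  show ?case
  proof (cases "Suc r \<le> d")
    case True
    have "1 - no_exceedance c (Suc r) \<le> real (Suc r) * tail c"
      using no_exceedance_decrement[of 0 "Suc r" c] by (simp add: no_exceedance_0)
    also have "\<dots> \<le> real d * tail c"
      using True tail_nonneg by (intro mult_right_mono) auto
    also have "\<dots> \<le> real d * tail c + real (Suc r) * lone_exceedance c d"
      using lone_exceedance_nonneg by simp
    finally show ?thesis .
  next
    case False
    then have "lone_exceedance c (Suc r) \<le> lone_exceedance c d"
      by (intro lone_exceedance_antimono) simp
    then show ?thesis
      using Suc.IH lone_exceedance_eq[of "Suc r" c] by (simp add: algebra_simps)
  qed
qed (use tail_nonneg in \<open>simp add: no_exceedance_0\<close>)

lemma lone_le_exceedance:
  "real r * lone_exceedance c r \<le> 1 - no_exceedance c r"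
proof -
  have "(\<Sum>m=1..r. lone_exceedance c r) \<le> (\<Sum>m=1..r. lone_exceedance c m)"
    by (intro sum_mono lone_exceedance_antimono) auto
  then show ?thesis by (simp add: one_minus_no_exceedance)
qed

end

text \<open>Replacing \<open>1 - x\<close> by \<open>exp (- x)\<close> in each of the \<open>k\<close> factors costs at most \<open>k * x\<^sup>2\<close>, which
  vanishes.\<close>

lemma power_one_minus_tendsto_exp:
  fixes x :: "nat \<Rightarrow> real" and k :: "nat \<Rightarrow> nat"
  assumes x: "\<And>n. 0 \<le> x n" "\<And>n. x n \<le> 1" and x0: "x \<longlonglongrightarrow> 0"
    and kx: "(\<lambda>n. real (k n) * x n) \<longlonglongrightarrow> \<mu>"
  shows "(\<lambda>n. (1 - x n) ^ k n) \<longlonglongrightarrow> exp (- \<mu>)"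
proof -
  have "(\<lambda>n. (real (k n) * x n) * x n) \<longlonglongrightarrow> 0"
    using tendsto_mult[OF kx x0] by simp
  then have "(\<lambda>n. (1 - x n) ^ k n - exp (- x n) ^ k n) \<longlonglongrightarrow> 0"
  proof (rule Lim_null_comparison[rotated], intro always_eventually allI)
    fix n
    have "exp (- x n) = 1 / exp (x n)" by (simp add: exp_minus inverse_eq_divide)
    also have "\<dots> \<le> 1 / (1 + x n)"
      using x[of n] by (intro divide_left_mono exp_ge_add_one_self mult_pos_pos) auto
    also have "\<dots> \<le> 1 - x n + x n * x n"
      using x[of n] by (simp add: field_simps)
    finally have "\<bar>(1 - x n) - exp (- x n)\<bar> \<le> x n * x n"
      using exp_ge_add_one_self[of "- x n"] by linarith
    then have "real (k n) * \<bar>(1 - x n) - exp (- x n)\<bar> \<le> real (k n) * (x n * x n)"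
      by (intro mult_left_mono) auto
    moreover have "norm ((1 - x n) ^ k n - exp (- x n) ^ k n) \<le> real (k n) * norm ((1 - x n) - exp (- x n))"
      using x[of n] by (intro norm_power_diff) auto
    ultimately show "norm ((1 - x n) ^ k n - exp (- x n) ^ k n) \<le> real (k n) * x n * x n"
      by (simp add: mult.assoc)
  qed
  moreover have "(\<lambda>n. exp (- x n) ^ k n) \<longlonglongrightarrow> exp (- \<mu>)"
    using tendsto_exp[OF tendsto_minus[OF kx]] by (simp flip: exp_of_nat_mult)
  ultimately show ?thesis
    using tendsto_add by fastforce
qed

context stationary_sequence
begin

text \<open>With \<open>k = n div r\<close> blocks of length \<open>r\<close>, block independence reduces the limit to that of
  \<open>(1 - x) ^ k\<close>, where \<open>x = 1 - no_exceedance c r\<close>, and the two bounds on \<open>x\<close> in terms of lone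
  exceedances give \<open>k * x \<longlonglongrightarrow> \<mu>\<close>.\<close>

lemma no_exceedance_tendsto_exp:
  fixes c A :: "nat \<Rightarrow> real" and r l :: "nat \<Rightarrow> nat"
  assumes tail: "(\<lambda>n. real n * tail (c n)) \<longlonglongrightarrow> \<tau>"
    and mix: "\<And>n. separated_mixing (c n) n (l n) (A n)"
    and r_top: "filterlim r at_top sequentially"
    and r_small: "(\<lambda>n. real (r n) / real n) \<longlonglongrightarrow> 0"
    and A: "(\<lambda>n. real n * A n / real (r n)) \<longlonglongrightarrow> 0"
    and l: "(\<lambda>n. real (l n) / real (r n)) \<longlonglongrightarrow> 0"
    and "d \<ge> 1"
    and lone: "(\<lambda>n. real n * lone_exceedance (c n) d) \<longlonglongrightarrow> \<mu>"
    and late: "(\<lambda>n. real n * late_return (c n) d (r n)) \<longlonglongrightarrow> 0"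
  shows "(\<lambda>n. no_exceedance (c n) n) \<longlonglongrightarrow> exp (- \<mu>)"
proof -
  define k where "k n = n div r n" for n
  define x where "x n = 1 - no_exceedance (c n) (r n)" for n
  have x01: "0 \<le> x n" "x n \<le> 1" for n
    using no_exceedance_bounds[of "c n" "r n"] by (auto simp: x_def)
  have r_ge: "\<forall>\<^sub>F n in sequentially. r n \<ge> d"
    using r_top by (simp add: filterlim_at_top)
  have kr: "k n * r n \<le> n" for n
    by (simp add: k_def)
  have k_le: "real (k n) \<le> real n / real (r n)" for n
    using of_nat_mono[OF kr[of n], where ?'a = real] by (cases "r n = 0") (auto simp: k_def field_simps)

  have rt: "(\<lambda>n. real (r n) * tail (c n)) \<longlonglongrightarrow> 0"
  proof (rule Lim_transform_eventually)
    show "(\<lambda>n. (real (r n) / real n) * (real n * tail (c n))) \<longlonglongrightarrow> 0"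
      using tendsto_mult[OF r_small tail] by simp
    show "\<forall>\<^sub>F n in sequentially. (real (r n) / real n) * (real n * tail (c n)) = real (r n) * tail (c n)"
      using eventually_gt_at_top[of 0] by eventually_elim simp
  qed
  have x0: "x \<longlonglongrightarrow> 0"
  proof (rule tendsto_sandwich[OF _ _ tendsto_const rt])
    show "\<forall>\<^sub>F n in sequentially. x n \<le> real (r n) * tail (c n)"
      using no_exceedance_decrement[of 0 "r n" "c n" for n]
      by (auto simp: x_def no_exceedance_0)
  qed (use x01 in auto)

  have kr_n: "(\<lambda>n. real (k n) * real (r n) / real n) \<longlonglongrightarrow> 1"
  proof (rule tendsto_sandwich)
    show "\<forall>\<^sub>F n in sequentially. 1 - real (r n) / real n \<le> real (k n) * real (r n) / real n"
      using eventually_gt_at_top[of 0] r_ge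
    proof eventually_elim
      case (elim n)
      have "n = k n * r n + n mod r n" by (simp add: k_def)
      moreover have "n mod r n < r n" using elim \<open>d \<ge> 1\<close> by simp
      ultimately have "real n \<le> real (k n) * real (r n) + real (r n)"
        by (metis add_left_mono less_imp_le of_nat_add of_nat_le_iff of_nat_mult)
      from divide_right_mono[OF this, of "real n"] show ?case
        using elim by (simp add: add_divide_distrib)
    qed
    show "\<forall>\<^sub>F n in sequentially. real (k n) * real (r n) / real n \<le> 1"
      using eventually_gt_at_top[of 0]
    proof eventually_elim
      case (elim n)
      then show ?case using of_nat_mono[OF kr[of n], where ?'a = real] by simp
    qed
    show "(\<lambda>n. 1 - real (r n) / real n) \<longlonglongrightarrow> 1"
      using tendsto_diff[OF tendsto_const r_small] by simp
  qed simp

  have kx: "(\<lambda>n. real (k n) * x n) \<longlonglongrightarrow> \<mu>"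
  proof (rule tendsto_sandwich)
    let ?f = "\<lambda>n. real (k n) * real (r n) / real n"
    let ?lo = "\<lambda>n. ?f n * (real n * lone_exceedance (c n) d - real n * late_return (c n) d (r n))"
    let ?hi = "\<lambda>n. real d * (inverse (real (r n)) * (real n * tail (c n)))
        + ?f n * (real n * lone_exceedance (c n) d)"
    show "?lo \<longlonglongrightarrow> \<mu>"
      using tendsto_mult[OF kr_n tendsto_diff[OF lone late]] by simp
    have "(\<lambda>n. inverse (real (r n))) \<longlonglongrightarrow> 0"
      by (intro tendsto_inverse_0_at_top filterlim_compose[OF filterlim_real_sequentially r_top])
    from tendsto_add[OF tendsto_mult[OF tendsto_const tendsto_mult[OF this tail]] tendsto_mult[OF kr_n lone]]
    show "?hi \<longlonglongrightarrow> \<mu>" by simp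
    show "\<forall>\<^sub>F n in sequentially. ?lo n \<le> real (k n) * x n"
      using eventually_gt_at_top[of 0] r_ge
    proof eventually_elim
      case (elim n)
      have "lone_exceedance (c n) d - late_return (c n) d (r n) = lone_exceedance (c n) (r n)"
        using elim late_return_eq[of d "r n" "c n"] \<open>d \<ge> 1\<close> by simp
      then have "?lo n = real (k n) * (real (r n) * lone_exceedance (c n) (r n))"
        using elim by (simp flip: right_diff_distrib)
      also have "\<dots> \<le> real (k n) * x n"
        unfolding x_def by (intro mult_left_mono lone_le_exceedance) auto
      finally show ?case .
    qed
    show "\<forall>\<^sub>F n in sequentially. real (k n) * x n \<le> ?hi n"
      using eventually_gt_at_top[of 0]
    proof eventually_elim
      case (elim n)
      have "real (k n) * x n \<le> real (k n) * (real d * tail (c n) + real (r n) * lone_exceedance (c n) d)"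
        unfolding x_def by (intro mult_left_mono exceedance_le_lone \<open>d \<ge> 1\<close>) auto
      also have "\<dots> = real (k n) * (real d * tail (c n)) + ?f n * (real n * lone_exceedance (c n) d)"
        using elim by (simp add: field_simps)
      also have "real (k n) * (real d * tail (c n)) \<le> (real n / real (r n)) * (real d * tail (c n))"
        using tail_nonneg by (intro mult_right_mono k_le) auto
      finally show ?case by (simp add: field_simps)
    qed
  qed

  have pow: "(\<lambda>n. no_exceedance (c n) (r n) ^ k n) \<longlonglongrightarrow> exp (- \<mu>)"
    using power_one_minus_tendsto_exp[OF x01 x0 kx] by (simp add: x_def)

  have "(\<lambda>n. no_exceedance (c n) (k n * r n) - no_exceedance (c n) (r n) ^ k n) \<longlonglongrightarrow> 0"
  proof (rule Lim_null_comparison)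
    let ?b = "\<lambda>n. 2 * ((real (l n) / real (r n)) * (real n * tail (c n))) + \<bar>real n * A n / real (r n)\<bar>"
    show "?b \<longlonglongrightarrow> 0"
      using tendsto_add[OF tendsto_mult[OF tendsto_const tendsto_mult[OF l tail]] tendsto_rabs_zero[OF A]]
      by simp
    have "\<forall>\<^sub>F n in sequentially. real (l n) / real (r n) < 1"
      using order_tendstoD(2)[OF l] by simp
    then show "\<forall>\<^sub>F n in sequentially.
        norm (no_exceedance (c n) (k n * r n) - no_exceedance (c n) (r n) ^ k n) \<le> ?b n"
      using r_ge
    proof eventually_elim
      case (elim n)
      then have "l n < r n" using \<open>d \<ge> 1\<close> by simp
      \<comment> \<open>A gap too long for two separated index sets to fit admits a negative bound.\<close>
      moreover have "separated_mixing (c n) n (l n) \<bar>A n\<bar>"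
        using mix[of n] unfolding separated_mixing_def by (meson abs_ge_self order_trans)
      ultimately have "norm (no_exceedance (c n) (k n * r n) - no_exceedance (c n) (r n) ^ k n)
          \<le> real (k n) * (2 * (real (l n) * tail (c n)) + \<bar>A n\<bar>)"
        using no_exceedance_near_power kr by simp
      also have "\<dots> \<le> (real n / real (r n)) * (2 * (real (l n) * tail (c n)) + \<bar>A n\<bar>)"
        using tail_nonneg by (intro mult_right_mono k_le) auto
      also have "\<dots> = ?b n"
        by (simp add: abs_mult add_divide_distrib algebra_simps)
      finally show ?case .
    qed
  qed
  from tendsto_add[OF this pow]
  have blocks: "(\<lambda>n. no_exceedance (c n) (k n * r n)) \<longlonglongrightarrow> exp (- \<mu>)" by simp

  have "(\<lambda>n. no_exceedance (c n) n - no_exceedance (c n) (k n * r n)) \<longlonglongrightarrow> 0"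
  proof (rule Lim_null_comparison[OF _ rt])
    show "\<forall>\<^sub>F n in sequentially.
        norm (no_exceedance (c n) n - no_exceedance (c n) (k n * r n)) \<le> real (r n) * tail (c n)"
      using r_ge
    proof eventually_elim
      case (elim n)
      have "n - k n * r n = n mod r n" by (simp add: k_def minus_div_mult_eq_mod)
      also have "\<dots> \<le> r n" using elim \<open>d \<ge> 1\<close> by (simp add: less_imp_le)
      finally have "real (n - k n * r n) * tail (c n) \<le> real (r n) * tail (c n)"
        using tail_nonneg by (intro mult_right_mono) auto
      then show ?case
        using no_exceedance_decrement[OF kr, of "c n" n] no_exceedance_antimono[OF kr, of "c n" n]
        by simp
    qed
  qed
  from tendsto_add[OF this blocks] show ?thesis by simp
qed

end

section \<open>Choice of the block length\<close>

text \<open>The block length supplied by the local condition need not be of smaller order than \<open>n\<close>. The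
  gaps \<open>l\<^sub>1\<close> supplied by the mixing condition alone admit the block length \<open>\<lceil>n w\<rceil>\<close> with
  \<open>w\<^sup>2 = \<bar>\<alpha> n (l\<^sub>1 n)\<bar> + l\<^sub>1 n / n + 1 / n\<close>, for which the three quantities to be controlled are at most
  of order \<open>w\<close>; taking at every \<open>n\<close> the shorter of the two lengths, with its own gap, keeps all
  requirements.\<close>

lemma obtain_short_blocks:
  fixes \<alpha> :: "nat \<Rightarrow> nat \<Rightarrow> real" and r\<^sub>0 l\<^sub>0 l\<^sub>1 :: "nat \<Rightarrow> nat"
  assumes r0: "filterlim r\<^sub>0 at_top sequentially"
    and A0: "(\<lambda>n. real n * \<alpha> n (l\<^sub>0 n) / real (r\<^sub>0 n)) \<longlonglongrightarrow> 0"
    and l0: "(\<lambda>n. real (l\<^sub>0 n) / real (r\<^sub>0 n)) \<longlonglongrightarrow> 0"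
    and A1: "(\<lambda>n. \<alpha> n (l\<^sub>1 n)) \<longlonglongrightarrow> 0"
    and l1: "(\<lambda>n. real (l\<^sub>1 n) / real n) \<longlonglongrightarrow> 0"
  obtains r l :: "nat \<Rightarrow> nat" where "filterlim r at_top sequentially"
    "(\<lambda>n. real (r n) / real n) \<longlonglongrightarrow> 0"
    "(\<lambda>n. real n * \<alpha> n (l n) / real (r n)) \<longlonglongrightarrow> 0"
    "(\<lambda>n. real (l n) / real (r n)) \<longlonglongrightarrow> 0"
    "\<And>n. r n \<le> r\<^sub>0 n"
proof -
  define w where "w n = sqrt (\<bar>\<alpha> n (l\<^sub>1 n)\<bar> + real (l\<^sub>1 n) / real n + 1 / real n)" for n
  define r\<^sub>1 where "r\<^sub>1 n = nat \<lceil>real n * w n\<rceil>" for n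
  define r where "r n = (if r\<^sub>0 n \<le> r\<^sub>1 n then r\<^sub>0 n else r\<^sub>1 n)" for n
  define l where "l n = (if r\<^sub>0 n \<le> r\<^sub>1 n then l\<^sub>0 n else l\<^sub>1 n)" for n
  have w2: "w n * w n = \<bar>\<alpha> n (l\<^sub>1 n)\<bar> + real (l\<^sub>1 n) / real n + 1 / real n" for n
    by (simp add: w_def)
  have w_nonneg: "0 \<le> w n" for n by (simp add: w_def)
  have w_pos: "0 < w n" if "n > 0" for n
    using that unfolding w_def by (intro real_sqrt_gt_zero add_nonneg_pos) auto
  have "(\<lambda>n. \<bar>\<alpha> n (l\<^sub>1 n)\<bar> + real (l\<^sub>1 n) / real n + 1 / real n) \<longlonglongrightarrow> 0"
    using tendsto_add[OF tendsto_add[OF tendsto_rabs_zero[OF A1] l1] lim_1_over_n] by simp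
  then have w0: "w \<longlonglongrightarrow> 0"
    unfolding w_def using tendsto_real_sqrt by fastforce
  have r1_ge: "real n * w n \<le> real (r\<^sub>1 n)" for n
    unfolding r\<^sub>1_def by (rule of_nat_ceiling)
  have r1_le: "real (r\<^sub>1 n) \<le> real n * w n + 1" for n
    unfolding r\<^sub>1_def using w_nonneg[of n] by (simp add: of_nat_nat)
  have ratio: "real n * y / real (r\<^sub>1 n) \<le> w n" if "n > 0" "0 \<le> y" "y \<le> w n * w n" for n y
  proof -
    have "real n * y / real (r\<^sub>1 n) \<le> real n * (w n * w n) / (real n * w n)"
      using that w_pos[of n] r1_ge[of n] by (intro frac_le mult_left_mono) auto
    then show ?thesis using that w_pos[of n] by simp
  qed
  have ev: "\<forall>\<^sub>F n::nat in sequentially. n > 0" by (rule eventually_gt_at_top)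

  have r1_top: "filterlim r\<^sub>1 at_top sequentially"
  proof -
    have "filterlim (\<lambda>n. sqrt (real n)) at_top sequentially"
      by (rule filterlim_compose[OF sqrt_at_top filterlim_real_sequentially])
    then have "filterlim (\<lambda>n. real (r\<^sub>1 n)) at_top sequentially"
    proof (rule filterlim_at_top_mono, intro always_eventually allI)
      fix n
      show "sqrt (real n) \<le> real (r\<^sub>1 n)"
      proof (cases "n = 0")
        case False
        have "sqrt (1 / real n) \<le> w n"
          unfolding w_def by (intro real_sqrt_le_mono) simp
        then have "real n * sqrt (1 / real n) \<le> real n * w n" by (rule mult_left_mono) simp
        moreover have "real n * sqrt (1 / real n) = sqrt (real n)"
          using False by (simp add: real_sqrt_divide real_div_sqrt)
        ultimately show ?thesis using r1_ge[of n] by simp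
      qed simp
    qed
    then show ?thesis by (simp add: filterlim_sequentially_iff_filterlim_real)
  qed
  show thesis
  proof (rule that[of r l])
    show "filterlim r at_top sequentially"
      unfolding filterlim_at_top
    proof
      fix Z
      have "\<forall>\<^sub>F n in sequentially. Z \<le> r\<^sub>0 n" "\<forall>\<^sub>F n in sequentially. Z \<le> r\<^sub>1 n"
        using r0 r1_top by (auto simp: filterlim_at_top)
      then show "\<forall>\<^sub>F n in sequentially. Z \<le> r n"
        by eventually_elim (simp add: r_def)
    qed
    show "r n \<le> r\<^sub>0 n" for n by (simp add: r_def)
    show "(\<lambda>n. real (r n) / real n) \<longlonglongrightarrow> 0"
    proof (rule tendsto_sandwich[OF _ _ tendsto_const])
      show "(\<lambda>n. w n + 1 / real n) \<longlonglongrightarrow> 0"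
        using tendsto_add[OF w0 lim_1_over_n] by simp
      show "\<forall>\<^sub>F n in sequentially. real (r n) / real n \<le> w n + 1 / real n"
        using ev
      proof eventually_elim
        case (elim n)
        have "real (r n) \<le> real (r\<^sub>1 n)" by (simp add: r_def)
        also note r1_le[of n]
        finally show ?case using elim by (simp add: field_simps)
      qed
    qed simp
    show "(\<lambda>n. real n * \<alpha> n (l n) / real (r n)) \<longlonglongrightarrow> 0"
    proof (rule Lim_null_comparison)
      show "(\<lambda>n. \<bar>real n * \<alpha> n (l\<^sub>0 n) / real (r\<^sub>0 n)\<bar> + w n) \<longlonglongrightarrow> 0"
        using tendsto_add[OF tendsto_rabs_zero[OF A0] w0] by simp
      show "\<forall>\<^sub>F n in sequentially. norm (real n * \<alpha> n (l n) / real (r n))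
          \<le> \<bar>real n * \<alpha> n (l\<^sub>0 n) / real (r\<^sub>0 n)\<bar> + w n"
        using ev
      proof eventually_elim
        case (elim n)
        have "real n * \<bar>\<alpha> n (l\<^sub>1 n)\<bar> / real (r\<^sub>1 n) \<le> w n"
          using elim by (intro ratio) (auto simp: w2)
        then show ?case
          using w_nonneg[of n] by (auto simp: r_def l_def abs_mult intro: add_increasing)
      qed
    qed
    show "(\<lambda>n. real (l n) / real (r n)) \<longlonglongrightarrow> 0"
    proof (rule Lim_null_comparison)
      show "(\<lambda>n. real (l\<^sub>0 n) / real (r\<^sub>0 n) + w n) \<longlonglongrightarrow> 0"
        using tendsto_add[OF l0 w0] by simp
      show "\<forall>\<^sub>F n in sequentially. norm (real (l n) / real (r n)) \<le> real (l\<^sub>0 n) / real (r\<^sub>0 n) + w n"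
        using ev
      proof eventually_elim
        case (elim n)
        have "real n * (real (l\<^sub>1 n) / real n) / real (r\<^sub>1 n) \<le> w n"
          using elim by (intro ratio) (auto simp: w2)
        then show ?case
          using w_nonneg[of n] elim by (auto simp: r_def l_def intro: add_increasing)
      qed
    qed
  qed
qed

section \<open>The extremal index\<close>

context stationary_sequence
begin

lemma condition_Dd_iff:
  "condition_Dd M X v \<alpha> d \<longleftrightarrow>
     (\<exists>r l :: nat \<Rightarrow> nat. filterlim r at_top sequentially \<and>
        (\<lambda>n. real n * \<alpha> n (l n) / real (r n)) \<longlonglongrightarrow> 0 \<and>
        (\<lambda>n. real (l n) / real (r n)) \<longlonglongrightarrow> 0 \<and>
        (\<lambda>n. real n * late_return (v n) d (r n)) \<longlonglongrightarrow> 0)"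
  unfolding condition_Dd_def late_return_def by (simp only: max_over_le_iff less_max_over_iff)

lemma max_below_tendsto_exp:
  assumes u: "thresholds M X u" and \<tau>: "\<tau> > 0" and "d \<ge> 1"
    and D: "condition_D M X (u \<tau>) \<alpha>" and Dd: "condition_Dd M X (u \<tau>) \<alpha> d"
    and ex: "stdf_exists M X u d"
  shows "(\<lambda>n. \<P>(\<omega> in M. max_over X {1..n} \<omega> \<le> ereal (u \<tau> n)))
           \<longlonglongrightarrow> exp (- (stdf M X u d (\<lambda>_. 1) - stdf M X u (d - 1) (\<lambda>_. 1)) * \<tau>)"
proof -
  obtain r\<^sub>0 l\<^sub>0 where 0: "filterlim r\<^sub>0 at_top sequentially"
    "(\<lambda>n. real n * \<alpha> n (l\<^sub>0 n) / real (r\<^sub>0 n)) \<longlonglongrightarrow> 0"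
    "(\<lambda>n. real (l\<^sub>0 n) / real (r\<^sub>0 n)) \<longlonglongrightarrow> 0"
    "(\<lambda>n. real n * late_return (u \<tau> n) d (r\<^sub>0 n)) \<longlonglongrightarrow> 0"
    using Dd unfolding condition_Dd_iff by blast
  obtain l\<^sub>1 where l1: "(\<lambda>n. real (l\<^sub>1 n)) \<in> o(\<lambda>n. real n)" "(\<lambda>n. \<alpha> n (l\<^sub>1 n)) \<longlonglongrightarrow> 0"
    using D unfolding condition_D_def by blast
  obtain r l where r: "filterlim r at_top sequentially"
    "(\<lambda>n. real (r n) / real n) \<longlonglongrightarrow> 0"
    "(\<lambda>n. real n * \<alpha> n (l n) / real (r n)) \<longlonglongrightarrow> 0"
    "(\<lambda>n. real (l n) / real (r n)) \<longlonglongrightarrow> 0"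
    "\<And>n. r n \<le> r\<^sub>0 n"
    using obtain_short_blocks[OF 0(1-3) l1(2) smalloD_tendsto[OF l1(1)]] by blast
  have "(\<lambda>n. real n * late_return (u \<tau> n) d (r n)) \<longlonglongrightarrow> 0"
    using late_return_nonneg late_return_mono[OF r(5)]
    by (intro tendsto_sandwich[OF _ _ tendsto_const 0(4)] always_eventually allI mult_left_mono) auto
  moreover have "(\<lambda>n. real n * tail (u \<tau> n)) \<longlonglongrightarrow> \<tau>"
    using u \<tau> by (simp add: thresholds_def tail_def)
  ultimately have "(\<lambda>n. no_exceedance (u \<tau> n) n)
      \<longlonglongrightarrow> exp (- (\<tau> * (stdf M X u d (\<lambda>_. 1) - stdf M X u (d - 1) (\<lambda>_. 1))))"
    using condition_D_separated_mixing[OF D] r \<open>d \<ge> 1\<close> lone_exceedance_tendsto[OF u ex \<open>d \<ge> 1\<close> \<tau>]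
    by (intro no_exceedance_tendsto_exp)
  then show ?thesis
    by (simp add: no_exceedance_def below_def max_over_le_iff algebra_simps)
qed

lemma stdf_increment_bounds:
  assumes u: "thresholds M X u" and ex: "stdf_exists M X u s" and "1 \<le> s"
  shows "stdf M X u s (\<lambda>_. 1) - stdf M X u (s - 1) (\<lambda>_. 1) \<in> {0..1}"
proof -
  have lone: "(\<lambda>n. real n * lone_exceedance (u 1 n) s)
      \<longlonglongrightarrow> stdf M X u s (\<lambda>_. 1) - stdf M X u (s - 1) (\<lambda>_. 1)"
    using lone_exceedance_tendsto[OF assms, of 1] by simp
  have tail: "(\<lambda>n. real n * tail (u 1 n)) \<longlonglongrightarrow> 1"
    using u by (simp add: thresholds_def tail_def)
  have "0 \<le> stdf M X u s (\<lambda>_. 1) - stdf M X u (s - 1) (\<lambda>_. 1)"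
    using lone_exceedance_nonneg by (intro LIMSEQ_le_const[OF lone]) auto
  moreover have "stdf M X u s (\<lambda>_. 1) - stdf M X u (s - 1) (\<lambda>_. 1) \<le> 1"
    using lone_exceedance_le_tail by (intro LIMSEQ_le[OF lone tail]) (auto intro!: mult_left_mono)
  ultimately show ?thesis by simp
qed

lemma stdf_increment_antimono:
  assumes u: "thresholds M X u" and ex: "stdf_exists M X u t" and "1 \<le> s" "s \<le> t"
  shows "stdf M X u t (\<lambda>_. 1) - stdf M X u (t - 1) (\<lambda>_. 1)
       \<le> stdf M X u s (\<lambda>_. 1) - stdf M X u (s - 1) (\<lambda>_. 1)"
proof (rule LIMSEQ_le)
  have exs: "stdf_exists M X u s"
    using stdf_exists_mono[OF prob_space_axioms measurable_X stationary u ex \<open>s \<le> t\<close>] .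
  show "(\<lambda>n. real n * lone_exceedance (u 1 n) t)
      \<longlonglongrightarrow> stdf M X u t (\<lambda>_. 1) - stdf M X u (t - 1) (\<lambda>_. 1)"
    using lone_exceedance_tendsto[OF u ex, of 1] assms by simp
  show "(\<lambda>n. real n * lone_exceedance (u 1 n) s)
      \<longlonglongrightarrow> stdf M X u s (\<lambda>_. 1) - stdf M X u (s - 1) (\<lambda>_. 1)"
    using lone_exceedance_tendsto[OF u exs, of 1] assms by simp
  show "\<exists>N. \<forall>n\<ge>N. real n * lone_exceedance (u 1 n) t \<le> real n * lone_exceedance (u 1 n) s"
    using lone_exceedance_antimono[OF \<open>s \<le> t\<close>] by (auto intro!: mult_left_mono)
qed

lemma condition_Dd_mono:
  assumes "condition_Dd M X v \<alpha> d" "d \<le> s"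
  shows "condition_Dd M X v \<alpha> s"
proof -
  have "(\<lambda>n. real n * late_return (v n) s (r n)) \<longlonglongrightarrow> 0"
    if "(\<lambda>n. real n * late_return (v n) d (r n)) \<longlonglongrightarrow> 0" for r
    using late_return_nonneg late_return_antimono[OF \<open>d \<le> s\<close>]
    by (intro tendsto_sandwich[OF _ _ tendsto_const that] always_eventually allI mult_left_mono) auto
  then show ?thesis using assms(1) unfolding condition_Dd_iff by blast
qed

text \<open>Equality of the increments at \<open>s\<close> and \<open>d\<close> says that a return between the times \<open>s\<close> and \<open>d\<close>
  is asymptotically negligible, so a block length that serves for \<open>d\<close> serves for \<open>s\<close>.\<close>

lemma condition_Dd_downward:
  assumes u: "thresholds M X u" and ex: "stdf_exists M X u d" and s: "1 \<le> s" "s \<le> d" and \<tau>: "\<tau> > 0"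
    and eq: "stdf M X u s (\<lambda>_. 1) - stdf M X u (s - 1) (\<lambda>_. 1)
           = stdf M X u d (\<lambda>_. 1) - stdf M X u (d - 1) (\<lambda>_. 1)"
    and Dd: "condition_Dd M X (u \<tau>) \<alpha> d"
  shows "condition_Dd M X (u \<tau>) \<alpha> s"
proof -
  have exs: "stdf_exists M X u s"
    using stdf_exists_mono[OF prob_space_axioms measurable_X stationary u ex \<open>s \<le> d\<close>] .
  have diff: "(\<lambda>n. real n * lone_exceedance (u \<tau> n) s - real n * lone_exceedance (u \<tau> n) d) \<longlonglongrightarrow> 0"
    using tendsto_diff[OF lone_exceedance_tendsto[OF u exs _ \<tau>] lone_exceedance_tendsto[OF u ex _ \<tau>]]
      s eq by simp
  have "(\<lambda>n. real n * late_return (u \<tau> n) s (r n)) \<longlonglongrightarrow> 0"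
    if late: "(\<lambda>n. real n * late_return (u \<tau> n) d (r n)) \<longlonglongrightarrow> 0" for r
  proof (rule tendsto_sandwich[OF _ _ tendsto_const])
    show "(\<lambda>n. (real n * lone_exceedance (u \<tau> n) s - real n * lone_exceedance (u \<tau> n) d)
        + real n * late_return (u \<tau> n) d (r n)) \<longlonglongrightarrow> 0"
      using tendsto_add[OF diff late] by simp
    show "\<forall>\<^sub>F n in sequentially. real n * late_return (u \<tau> n) s (r n)
        \<le> (real n * lone_exceedance (u \<tau> n) s - real n * lone_exceedance (u \<tau> n) d)
            + real n * late_return (u \<tau> n) d (r n)"
      using mult_left_mono[OF late_return_split[OF s, of "u \<tau> n" "r n" for n], of "real n" for n]
      by (simp add: algebra_simps)
  qed (use late_return_nonneg in auto)
  then show ?thesis using Dd unfolding condition_Dd_iff by blast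
qed

text \<open>Under the local condition at \<open>d\<close> the increments are constant from \<open>d\<close> on: their difference is
  the rate of returns between \<open>d\<close> and \<open>s\<close>, and these fall inside the block.\<close>

lemma stdf_increment_eq_above:
  assumes u: "thresholds M X u" and Dd: "condition_Dd M X (u 1) \<alpha> d"
    and ex: "stdf_exists M X u s" and d: "1 \<le> d" "d \<le> s"
  shows "stdf M X u s (\<lambda>_. 1) - stdf M X u (s - 1) (\<lambda>_. 1)
       = stdf M X u d (\<lambda>_. 1) - stdf M X u (d - 1) (\<lambda>_. 1)"
proof -
  obtain r where r: "filterlim r at_top sequentially"
    and late: "(\<lambda>n. real n * late_return (u 1 n) d (r n)) \<longlonglongrightarrow> 0"
    using Dd unfolding condition_Dd_iff by blast
  have exd: "stdf_exists M X u d"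
    using stdf_exists_mono[OF prob_space_axioms measurable_X stationary u ex \<open>d \<le> s\<close>] .
  have "(\<lambda>n. real n * lone_exceedance (u 1 n) d - real n * lone_exceedance (u 1 n) s) \<longlonglongrightarrow>
      (stdf M X u d (\<lambda>_. 1) - stdf M X u (d - 1) (\<lambda>_. 1))
      - (stdf M X u s (\<lambda>_. 1) - stdf M X u (s - 1) (\<lambda>_. 1))"
    using tendsto_diff[OF lone_exceedance_tendsto[OF u exd, of 1] lone_exceedance_tendsto[OF u ex, of 1]] d
    by simp
  moreover have "(\<lambda>n. real n * lone_exceedance (u 1 n) d - real n * lone_exceedance (u 1 n) s) \<longlonglongrightarrow> 0"
  proof (rule tendsto_sandwich[OF _ _ tendsto_const late])
    have "\<forall>\<^sub>F n in sequentially. s \<le> r n"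
      using r by (simp add: filterlim_at_top)
    then show "\<forall>\<^sub>F n in sequentially. real n * lone_exceedance (u 1 n) d - real n * lone_exceedance (u 1 n) s
        \<le> real n * late_return (u 1 n) d (r n)"
    proof eventually_elim
      case (elim n)
      have "lone_exceedance (u 1 n) d - lone_exceedance (u 1 n) s \<le> late_return (u 1 n) d (r n)"
        using late_return_eq[OF d] late_return_mono[OF elim] by metis
      then show ?case by (simp add: mult_left_mono flip: right_diff_distrib)
    qed
    show "\<forall>\<^sub>F n in sequentially.
        0 \<le> real n * lone_exceedance (u 1 n) d - real n * lone_exceedance (u 1 n) s"
      using lone_exceedance_antimono[OF \<open>d \<le> s\<close>] by (simp add: mult_left_mono)
  qed
  ultimately show ?thesis using LIMSEQ_unique by fastforce
qed

end

theorem theorem2p1: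
  fixes M :: "'a measure"
    and X :: "nat \<Rightarrow> 'a \<Rightarrow> real"
    and u :: "real \<Rightarrow> nat \<Rightarrow> real"
    and \<alpha> :: "real \<Rightarrow> nat \<Rightarrow> nat \<Rightarrow> real"
    and d :: nat
  assumes "prob_space M"
    and "\<And>i. i \<ge> 1 \<Longrightarrow> X i \<in> borel_measurable M"
    and "strictly_stationary M X"
    and "continuous_on UNIV (cdf (distr M borel (X 1)))"
    and "thresholds M X u"
    and "d \<ge> 1"
    and "\<And>\<tau>. \<tau> > 0 \<Longrightarrow> condition_D M X (u \<tau>) (\<alpha> \<tau>)"
    and "\<And>\<tau>. \<tau> > 0 \<Longrightarrow> condition_Dd M X (u \<tau>) (\<alpha> \<tau>) d"
    and "stdf_exists M X u d"
  shows "\<exists>\<theta>. has_extremal_index M X u \<theta> \<and>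
           \<theta> = stdf M X u d (\<lambda>_. 1) - stdf M X u (d - 1) (\<lambda>_. 1) \<and>
           \<theta> \<in> {0..1} \<and>
           (\<forall>s\<^sub>0\<ge>d. stdf_exists M X u s\<^sub>0 \<longrightarrow>
              (\<exists>d'. 1 \<le> d' \<and> d' \<le> d \<and>
                 (\<forall>s. d' \<le> s \<and> s \<le> s\<^sub>0 \<longrightarrow>
                    (\<forall>\<tau>>0. condition_Dd M X (u \<tau>) (\<alpha> \<tau>) s) \<and>
                    stdf M X u s (\<lambda>_. 1) - stdf M X u (s - 1) (\<lambda>_. 1) = \<theta>) \<and>
                 (\<forall>s. 1 \<le> s \<and> s < d' \<longrightarrow>
                    stdf M X u s (\<lambda>_. 1) - stdf M X u (s - 1) (\<lambda>_. 1) > \<theta>)))"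
proof -
  interpret stationary_sequence M X
    using assms(1-3) by (simp add: stationary_sequence_def stationary_sequence_axioms_def)
  note u = assms(5) and d = assms(6) and D = assms(7) and Dd = assms(8) and ex = assms(9)
  define e where "e s = stdf M X u s (\<lambda>_. 1) - stdf M X u (s - 1) (\<lambda>_. 1)" for s
  have bounds: "e d \<in> {0..1}"
    unfolding e_def using stdf_increment_bounds[OF u ex d] .
  have index: "has_extremal_index M X u (e d)"
    unfolding has_extremal_index_def
    using bounds max_below_tendsto_exp[OF u _ d D Dd ex] by (simp add: e_def)
  have threshold: "\<exists>d'. 1 \<le> d' \<and> d' \<le> d \<and>
      (\<forall>s. d' \<le> s \<and> s \<le> s\<^sub>0 \<longrightarrow> (\<forall>\<tau>>0. condition_Dd M X (u \<tau>) (\<alpha> \<tau>) s) \<and> e s = e d) \<and>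
      (\<forall>s. 1 \<le> s \<and> s < d' \<longrightarrow> e s > e d)"
    if "stdf_exists M X u s\<^sub>0" for s\<^sub>0
  proof -
    define d' where "d' = (LEAST s. 1 \<le> s \<and> e s = e d)"
    have d': "1 \<le> d'" "e d' = e d"
      using LeastI[of "\<lambda>s. 1 \<le> s \<and> e s = e d" d] d by (auto simp: d'_def)
    have d'_le: "d' \<le> d"
      using Least_le[of "\<lambda>s. 1 \<le> s \<and> e s = e d" d] d by (simp add: d'_def)
    have anti: "e t \<le> e s" if "1 \<le> s" "s \<le> t" "t \<le> d" for s t
      unfolding e_def
      using stdf_exists_mono[OF assms(1-3) u ex \<open>t \<le> d\<close>] that
      by (intro stdf_increment_antimono[OF u]) auto
    have "e s > e d" if "1 \<le> s" "s < d'" for s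
      using anti[of s d] not_less_Least[of s "\<lambda>s. 1 \<le> s \<and> e s = e d"] that d'_le
      by (fastforce simp: d'_def)
    moreover have "(\<forall>\<tau>>0. condition_Dd M X (u \<tau>) (\<alpha> \<tau>) s) \<and> e s = e d" if "d' \<le> s" "s \<le> s\<^sub>0" for s
    proof (cases "s \<le> d")
      case True
      then have "e s = e d"
        using anti[of d' s] anti[of s d] d' that by simp
      then show ?thesis
        using condition_Dd_downward[OF u ex _ True _ _ Dd] d' that by (auto simp: e_def)
    next
      case False
      have "stdf_exists M X u s"
        using stdf_exists_mono[OF assms(1-3) u \<open>stdf_exists M X u s\<^sub>0\<close> \<open>s \<le> s\<^sub>0\<close>] .
      then show ?thesis
        using False condition_Dd_mono[OF Dd] stdf_increment_eq_above[OF u Dd[of 1] _ d]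
        by (auto simp: e_def)
    qed
    ultimately show ?thesis using d' d'_le by blast
  qed
  show ?thesis
    using index bounds threshold unfolding e_def by blast
qed

end
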